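(* Let $X$ be a real Banach space with $\dim X\ge 3$ such that every element of $X$ is a Flinn element, i.e. $\mathcal{F}(X)=X$. Then $X$ is isometric to a Hilbert space.
   Context: A bounded linear operator $T:X\to X$ on a real Banach space is numerically positive if for every $x\in X$ and every $x^*\in X^*$ with $\|x^*\|^2=\|x\|^2=x^*(x)$ one has $x^*(Tx)\ge 0$. An element $u\in X$ is a Flinn element if there is a numerically positive linear projection of $X$ onto $\operatorname{span}\{u\}$; for $u\neq 0$ this means there exists $f\in X^*$ with $f(u)=1$ such that the map $f\otimes u: x\mapsto f(x)u$ is numerically positive (then $(u,f)$ is called a Flinn pair). The element $0$ is a Flinn element (the zero projection). $\mathcal{F}(X)$ denotes the set of all Flinn elements of $X$. *)

theory Defs
  imports "HOL-Analysis.Analysis"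
begin

definition dual_pair :: "('a::real_normed_vector) \<Rightarrow> ('a \<Rightarrow> real) \<Rightarrow> bool" where
  "dual_pair x f \<longleftrightarrow> bounded_linear f \<and> (onorm f)\<^sup>2 = (norm x)\<^sup>2 \<and> (norm x)\<^sup>2 = f x"

definition numerically_positive :: "(('a::real_normed_vector) \<Rightarrow> 'a) \<Rightarrow> bool" where
  "numerically_positive T \<longleftrightarrow> bounded_linear T \<and>
     (\<forall>x f. dual_pair x f \<longrightarrow> f (T x) \<ge> 0)"

definition flinn_element :: "('a::real_normed_vector) \<Rightarrow> bool" where
  "flinn_element u \<longleftrightarrow> (\<exists>P. bounded_linear P \<and> (\<forall>x. P (P x) = P x) \<and>
      range P = span {u} \<and> numerically_positive P)"

definition flinn_set :: "('a::real_normed_vector) set" where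
  "flinn_set = {u. flinn_element u}"

text \<open>The norm of X is induced by an inner product (so, X being complete,
  X is a Hilbert space under its own norm).\<close>
definition norm_from_inner_product :: "('a::real_normed_vector) itself \<Rightarrow> bool" where
  "norm_from_inner_product _ \<longleftrightarrow> (\<exists>ip :: 'a \<Rightarrow> 'a \<Rightarrow> real.
      (\<forall>x y. ip x y = ip y x) \<and>
      (\<forall>y. linear (\<lambda>x. ip x y)) \<and>
      (\<forall>x. x \<noteq> 0 \<longrightarrow> ip x x > 0) \<and>
      (\<forall>x. norm x = sqrt (ip x x)))"

end

theory Submission
  imports Defs
begin

text \<open>
  A rank-one projection \<open>f\<^sub>u \<otimes> u\<close> is numerically positive iff \<open>I - f\<^sub>u \<otimes> u\<close> is a contraction, so it is
  enough to show that then all reflections \<open>I - 2 f\<^sub>u \<otimes> u\<close> are isometries: they exchange vectors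
  of equal norm, which makes \<open>\<parallel>u\<parallel>\<^sup>2 f\<^sub>u(x)\<close> symmetric, hence an inner product.

  The key step is three-dimensional and follows Blaschke. Let \<open>G\<close> support the unit ball at \<open>v\<close>. The
  ball has no two-dimensional faces, so \<open>f\<^sub>u(v) = 0\<close> for all \<open>u \<in> ker G\<close> outside one line, and
  \<open>x \<mapsto> x - f\<^sub>u(x) u\<close> maps each section \<open>{x \<in> ker G. \<parallel>v + x\<parallel> \<le> r}\<close> and its reflection
  \<open>{x \<in> ker G. \<parallel>v - x\<parallel> \<le> r}\<close> into themselves. Therefore the support functions of these two
  planar bodies have the same logarithmic derivative, so they are proportional, and
  the sections are symmetric: \<open>\<parallel>v + x\<parallel> = \<parallel>v - x\<parallel>\<close>.
\<close>

section \<open>Norming functionals and contractions\<close>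

definition sublinear :: "('a::real_vector \<Rightarrow> real) \<Rightarrow> bool" where
  "sublinear q \<longleftrightarrow> (\<forall>x y. q (x + y) \<le> q x + q y) \<and> (\<forall>c x. c \<ge> 0 \<longrightarrow> q (c *\<^sub>R x) = c * q x)"

lemma sublinear_add: "sublinear q \<Longrightarrow> q (x + y) \<le> q x + q y"
  and sublinear_scale: "sublinear q \<Longrightarrow> c \<ge> 0 \<Longrightarrow> q (c *\<^sub>R x) = c * q x"
  by (auto simp: sublinear_def)

lemma sublinear_zero: "sublinear q \<Longrightarrow> q 0 = 0"
  using sublinear_scale[of q 0 0] by simp

lemma sublinear_minus: "sublinear q \<Longrightarrow> - q (- x) \<le> q x"
  using sublinear_add[of q x "- x"] sublinear_zero[of q] by simp

lemma sublinear_norm: "sublinear (norm :: 'a::real_normed_vector \<Rightarrow> real)"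
  by (auto simp: sublinear_def norm_triangle_ineq)

text \<open>The infimum of \<open>S x\<close> is the largest sublinear minorant of \<open>q\<close>
  whose value at \<open>- y\<close> is at most \<open>- q y\<close>; the lower bound
  \<open>- q (- x)\<close> keeps it finite.\<close>

lemma sublinear_decrease:
  fixes q :: "'a::real_vector \<Rightarrow> real"
  assumes q: "sublinear q"
  obtains r where "sublinear r" "r \<le> q" "\<And>x. r x \<le> q (x + y) - q y"
proof -
  define S where "S x = {q (x + t *\<^sub>R y) - t * q y | t. t \<ge> 0}" for x
  define r where "r x = Inf (S x)" for x
  have ne: "S x \<noteq> {}" for x unfolding S_def by auto
  have lb: "- q (- x) \<le> z" if "z \<in> S x" for x z
  proof -
    obtain t where t: "t \<ge> 0" "z = q (x + t *\<^sub>R y) - t * q y" using \<open>z \<in> S x\<close> by (auto simp: S_def)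
    have "q (t *\<^sub>R y) \<le> q (x + t *\<^sub>R y) + q (- x)"
      using sublinear_add[OF q, of "x + t *\<^sub>R y" "- x"] by simp
    with t show ?thesis by (simp add: sublinear_scale[OF q])
  qed
  then have bdd: "bdd_below (S x)" for x by (meson bdd_belowI)
  have r_le: "r x \<le> q (x + t *\<^sub>R y) - t * q y" if "t \<ge> 0" for x t
    unfolding r_def using that by (intro cInf_lower bdd) (auto simp: S_def)
  have r_ge: "m \<le> r x" if "\<And>t. t \<ge> 0 \<Longrightarrow> m \<le> q (x + t *\<^sub>R y) - t * q y" for m x
    unfolding r_def using ne that by (intro cInf_greatest) (auto simp: S_def)
  have "r (x1 + x2) \<le> r x1 + r x2" for x1 x2
  proof -
    have "r (x1 + x2) - (q (x1 + t *\<^sub>R y) - t * q y) \<le> q (x2 + u *\<^sub>R y) - u * q y"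
      if "t \<ge> 0" "u \<ge> 0" for t u
      using r_le[of "t + u" "x1 + x2"] that sublinear_add[OF q, of "x1 + t *\<^sub>R y" "x2 + u *\<^sub>R y"]
      by (simp add: algebra_simps)
    then have "r (x1 + x2) - (q (x1 + t *\<^sub>R y) - t * q y) \<le> r x2" if "t \<ge> 0" for t
      using that by (intro r_ge) auto
    then have "r (x1 + x2) - r x2 \<le> r x1" by (intro r_ge) (simp add: algebra_simps)
    then show ?thesis by simp
  qed
  moreover have "r (c *\<^sub>R x) = c * r x" if "c \<ge> 0" for c x
  proof (cases "c = 0")
    case True
    have "0 \<le> r 0" by (intro r_ge) (simp add: sublinear_scale[OF q])
    moreover have "r 0 \<le> 0" using r_le[of 0 0] by (simp add: sublinear_zero[OF q])
    ultimately show ?thesis using True by simp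
  next
    case False
    with that have c: "c > 0" by simp
    \<comment> \<open>One inequality for all positive factors suffices: the other comes from scaling
      back by \<open>1/c\<close>.\<close>
    have le: "r (c *\<^sub>R x) \<le> c * r x" if c: "c > 0" for c x
    proof -
      have "r (c *\<^sub>R x) / c \<le> r x"
      proof (intro r_ge)
        fix t :: real assume t: "t \<ge> 0"
        have "r (c *\<^sub>R x) \<le> q (c *\<^sub>R x + (c * t) *\<^sub>R y) - c * t * q y"
          using c t by (intro r_le) simp
        also have "c *\<^sub>R x + (c * t) *\<^sub>R y = c *\<^sub>R (x + t *\<^sub>R y)" by (simp add: algebra_simps)
        also have "q (c *\<^sub>R (x + t *\<^sub>R y)) = c * q (x + t *\<^sub>R y)"
          using c by (simp add: sublinear_scale[OF q])
        finally show "r (c *\<^sub>R x) / c \<le> q (x + t *\<^sub>R y) - t * q y"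
          using c by (simp add: field_simps)
      qed
      then show ?thesis using c by (simp add: field_simps)
    qed
    have "r x \<le> (1/c) * r (c *\<^sub>R x)" using le[of "1/c" "c *\<^sub>R x"] c by simp
    then show ?thesis using le[OF c, of x] c by (simp add: field_simps)
  qed
  ultimately have "sublinear r" by (simp add: sublinear_def)
  moreover have "r \<le> q" using r_le[of 0] by (simp add: le_fun_def)
  moreover have "r x \<le> q (x + y) - q y" for x using r_le[of 1 x] by simp
  ultimately show ?thesis by (rule that)
qed

text \<open>Zorn's lemma for the reversed pointwise order, where maximal means minimal. A nonempty
  chain is bounded by its pointwise infimum, which is finite because every member is at least
  \<open>- p (- x)\<close> at \<open>x\<close>.\<close>

lemma minimal_sublinear_exists:
  fixes p :: "'a::real_vector \<Rightarrow> real"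
  assumes p: "sublinear p"
  obtains q where "sublinear q" "q \<le> p" "\<And>r. sublinear r \<Longrightarrow> r \<le> q \<Longrightarrow> r = q"
proof -
  define A where "A = {q. sublinear q \<and> q \<le> p}"
  have po: "partial_order_on A (relation_of (\<ge>) A)"
    by (rule partial_order_on_relation_ofI) auto
  have "\<exists>u\<in>A. \<forall>a\<in>C. u \<le> a" if C: "C \<in> Chains (relation_of (\<ge>) A)" for C
  proof (cases "C = {}")
    case True
    then show ?thesis using p by (auto simp: A_def)
  next
    case False
    have CA: "C \<subseteq> A" using C by (auto simp: Chains_def relation_of_def)
    have chain: "a \<le> b \<or> b \<le> a" if "a \<in> C" "b \<in> C" for a b
      using C that by (auto simp: Chains_def relation_of_def)
    define u where "u x = (INF a\<in>C. a x)" for x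
    have lb: "- p (- x) \<le> a x" if "a \<in> C" for a x
    proof -
      have "sublinear a" "a \<le> p" using that CA by (auto simp: A_def)
      then show ?thesis using sublinear_minus[of a x] le_funD[of a p "- x"] by linarith
    qed
    then have bdd: "bdd_below ((\<lambda>a. a x) ` C)" for x by (intro bdd_belowI2)
    have u_le: "u x \<le> a x" if "a \<in> C" for a x
      unfolding u_def using that bdd by (intro cINF_lower)
    have u_ge: "m \<le> u x" if "\<And>a. a \<in> C \<Longrightarrow> m \<le> a x" for m x
      unfolding u_def using that False by (intro cINF_greatest)
    have "u (x + y) \<le> u x + u y" for x y
    proof -
      \<comment> \<open>One of two chain members lies below both, and its subadditivity is the one
        to use.\<close>
      have "u (x + y) - a x \<le> b y" if ab: "a \<in> C" "b \<in> C" for a b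
      proof -
        obtain m where m: "m \<in> C" "m \<le> a" "m \<le> b" using chain[OF ab] ab by blast
        then have "sublinear m" using CA by (auto simp: A_def)
        then show ?thesis
          using u_le[OF m(1), of "x + y"] sublinear_add[of m x y] 
            le_funD[OF m(2), of x] le_funD[OF m(3), of y]
          by linarith
      qed
      then have "u (x + y) - a x \<le> u y" if "a \<in> C" for a using that by (intro u_ge)
      then have "u (x + y) - u y \<le> u x" by (intro u_ge) (simp add: algebra_simps)
      then show ?thesis by simp
    qed
    moreover have "u (c *\<^sub>R x) = c * u x" if "c \<ge> 0" for c x
    proof -
      have sc: "a (c *\<^sub>R x) = c * a x" if "a \<in> C" for a
        using that CA \<open>c \<ge> 0\<close> by (auto simp: A_def sublinear_scale)
      show ?thesis
      proof (rule antisym)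
        show "c * u x \<le> u (c *\<^sub>R x)"
          using u_le that by (intro u_ge) (simp add: sc mult_left_mono)
        show "u (c *\<^sub>R x) \<le> c * u x"
        proof (cases "c = 0")
          case True
          then show ?thesis using u_le[of _ "c *\<^sub>R x"] sc False by force
        next
          case False
          have "u (c *\<^sub>R x) / c \<le> u x"
            using u_le[of _ "c *\<^sub>R x"] sc False that by (intro u_ge) (simp add: field_simps)
          then show ?thesis using False that by (simp add: field_simps)
        qed
      qed
    qed
    ultimately have "sublinear u" by (simp add: sublinear_def)
    moreover have "u \<le> p" 
    proof -
      obtain a where "a \<in> C" using False by blast
      then have "a \<le> p" using CA by (auto simp: A_def)
      then show ?thesis using u_le[OF \<open>a \<in> C\<close>] by (auto simp: le_fun_def intro: order_trans)
    qed
    ultimately show ?thesis using u_le by (auto simp: A_def le_fun_def)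
  qed
  from predicate_Zorn[OF po this] obtain q where "q \<in> A" "\<forall>a\<in>A. a \<le> q \<longrightarrow> a = q" by blast
  then show ?thesis using that by (auto simp: A_def intro: order_trans)
qed

text \<open>Hahn--Banach: a minimal sublinear functional is linear, since \<open>sublinear_decrease\<close> applied to
  it gives superadditivity.\<close>

lemma sublinear_dominates_linear:
  fixes p :: "'a::real_vector \<Rightarrow> real"
  assumes p: "sublinear p"
  obtains f where "linear f" "\<And>x. f x \<le> p x"
proof -
  obtain q where q: "sublinear q" "q \<le> p" and min: "\<And>r. sublinear r \<Longrightarrow> r \<le> q \<Longrightarrow> r = q"
    using minimal_sublinear_exists[OF p] by blast
  have add: "q (x + y) = q x + q y" for x y
  proof -
    obtain r where "sublinear r" "r \<le> q" "\<And>x. r x \<le> q (x + y) - q y"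
      using sublinear_decrease[OF q(1)] by blast
    with min have "q x \<le> q (x + y) - q y" by metis
    then show ?thesis using sublinear_add[OF q(1), of x y] by simp
  qed
  have neg: "q (- x) = - q x" for x
    using add[of x "- x"] sublinear_zero[OF q(1)] by simp
  have "q (c *\<^sub>R x) = c * q x" for c x
  proof (cases "c \<ge> 0")
    case False
    then have "q ((- c) *\<^sub>R x) = (- c) * q x" by (intro sublinear_scale[OF q(1)]) simp
    then show ?thesis by (simp add: neg)
  qed (rule sublinear_scale[OF q(1)])
  with add have "linear q" by (intro linearI) simp_all
  with q(2) show ?thesis using that by (auto simp: le_fun_def)
qed

text \<open>The norm is first lowered so that its value at \<open>- a\<close> is at most
  \<open>- norm a\<close>; a linear minorant of the result must then reach \<open>norm a\<close> at
  \<open>a\<close>.\<close>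

lemma norming_functional_exists:
  fixes a :: "'a::real_normed_vector"
  obtains f where "linear f" "\<And>x. f x \<le> norm x" "f a = norm a"
proof -
  obtain r where r: "sublinear r" "r \<le> norm" "\<And>x. r x \<le> norm (x + a) - norm a"
    using sublinear_decrease[OF sublinear_norm] by blast
  obtain f where f: "linear f" "\<And>x. f x \<le> r x" using sublinear_dominates_linear[OF r(1)] by blast
  have le: "f x \<le> norm x" for x using f(2)[of x] r(2) by (auto simp: le_fun_def intro: order_trans)
  have "f (- a) \<le> - norm a" using f(2)[of "- a"] r(3)[of "- a"] by simp
  then have "f a = norm a" using le[of a] by (simp add: linear_neg[OF f(1)])
  with f(1) le show ?thesis by (rule that)
qed

lemma dual_pair_exists: "\<exists>f. dual_pair x f"
proof -
  obtain g where g: "linear g" "\<And>y. g y \<le> norm y" "g x = norm x"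
    using norming_functional_exists[of x] by blast
  have abs: "\<bar>g y\<bar> \<le> norm y" for y
    using g(2)[of y] g(2)[of "- y"] by (simp add: linear_neg[OF g(1)] abs_le_iff)
  define f where "f y = norm x * g y" for y
  have "linear f" unfolding f_def
    using linear_compose_scale_right[OF g(1), of "norm x"] by simp
  moreover have bd: "norm (f y) \<le> norm x * norm y" for y
    using abs[of y] by (simp add: f_def abs_mult mult_left_mono)
  ultimately have bl: "bounded_linear f"
    by (auto intro!: bounded_linear_intro[where K = "norm x"] simp: linear_add linear_scale mult.commute)
  have "onorm f \<le> norm x" by (rule onorm_bound) (simp, rule bd)
  moreover have "norm x \<le> onorm f"
  proof (cases "x = 0")
    case False
    have "norm x * norm x \<le> onorm f * norm x"
      using onorm[OF bl, of x] by (simp add: f_def g(3))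
    then show ?thesis using False by simp
  qed (simp add: onorm_pos_le[OF bl])
  ultimately show ?thesis
    using bl by (intro exI[of _ f]) (simp add: dual_pair_def f_def g(3) power2_eq_square)
qed

text \<open>For \<open>y = x - t P x\<close> and \<open>f\<close> dual to \<open>y\<close>,
  positivity and \<open>P y = (1 - t) P x\<close> give \<open>f (P x) \<ge> 0\<close>, so the
  squared norm of \<open>y\<close> is at most \<open>f x\<close>. At \<open>t = 1\<close> one has
  \<open>P y = 0\<close> and positivity says nothing, hence the limit from the left.\<close>

lemma numerically_positive_projection_complement_contractive:
  fixes P :: "'a::real_normed_vector \<Rightarrow> 'a"
  assumes P: "numerically_positive P" and proj: "\<And>x. P (P x) = P x"
  shows "norm (x - P x) \<le> norm x"
proof -
  have blP: "bounded_linear P" and pos: "\<And>x f. dual_pair x f \<Longrightarrow> f (P x) \<ge> 0"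
    using P by (auto simp: numerically_positive_def)
  interpret P: bounded_linear P by (rule blP)
  have le: "norm (x - t *\<^sub>R P x) \<le> norm x" if t: "t < 1" "0 \<le> t" for t
  proof -
    define y where "y = x - t *\<^sub>R P x"
    obtain f where f: "dual_pair y f" using dual_pair_exists by blast
    then interpret f: bounded_linear f by (simp add: dual_pair_def)
    have "onorm f = norm y" and fy: "f y = (norm y)\<^sup>2"
      using f onorm_pos_le[OF f.bounded_linear_axioms] by (auto simp: dual_pair_def power2_eq_iff_nonneg)
    then have bd: "f x \<le> norm y * norm x" using onorm[OF f.bounded_linear_axioms, of x] by simp
    have "P y = (1 - t) *\<^sub>R P x" by (simp add: y_def P.diff P.scaleR proj algebra_simps)
    then have "(1 - t) * f (P x) \<ge> 0" using pos[OF f] by (simp add: f.scaleR)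
    then have "f (P x) \<ge> 0" using t by (simp add: zero_le_mult_iff)
    moreover have "f y = f x - t * f (P x)" by (simp add: y_def f.diff f.scaleR)
    ultimately have "norm y * norm y \<le> norm y * norm x"
      using fy bd t(2) mult_nonneg_nonneg[OF t(2), of "f (P x)"]
      unfolding power2_eq_square by linarith
    then show ?thesis unfolding y_def[symmetric] by (cases "norm y = 0") auto
  qed
  have "((\<lambda>t. norm (x - t *\<^sub>R P x)) \<longlongrightarrow> norm (x - 1 *\<^sub>R P x)) (at_left 1)"
    by (intro tendsto_intros)
  moreover have "\<forall>\<^sub>F t in at_left (1::real). norm (x - t *\<^sub>R P x) \<le> norm x"
    using eventually_at_left_real[of 0 1] by (auto elim!: eventually_mono intro!: le)
  ultimately have "norm (x - 1 *\<^sub>R P x) \<le> norm x"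
    by (intro tendsto_upperbound) auto
  then show ?thesis by simp
qed

lemma flinn_element_functional:
  fixes u :: "'a::real_normed_vector"
  assumes "flinn_element u" "u \<noteq> 0"
  obtains f where "linear f" "f u = 1" "\<And>x. norm (x - f x *\<^sub>R u) \<le> norm x"
proof -
  obtain P where P: "bounded_linear P" "\<And>x. P (P x) = P x" "range P = span {u}"
      "numerically_positive P"
    using assms(1) by (auto simp: flinn_element_def)
  interpret P: bounded_linear P by (rule P(1))
  have "\<exists>c. P x = c *\<^sub>R u" for x
  proof -
    have "P x \<in> span {u}" using P(3) by blast
    then show ?thesis by (auto simp: span_singleton)
  qed
  then obtain f where f: "\<And>x. P x = f x *\<^sub>R u" by metis
  have "linear f"
  proof (rule linearI)
    show "f (x + y) = f x + f y" for x y
      using P.add[of x y] assms(2) by (simp add: f flip: scaleR_add_left)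
    show "f (c *\<^sub>R x) = c *\<^sub>R f x" for c x
      using P.scaleR[of c x] assms(2) by (simp add: f)
  qed
  moreover have "f u = 1"
  proof -
    have "u \<in> range P" unfolding P(3) by (simp add: span_base)
    then have "P u = u" using P(2) by auto
    then have "f u *\<^sub>R u = 1 *\<^sub>R u" by (simp add: f)
    then show ?thesis using assms(2) by (simp only: scaleR_cancel_right) simp
  qed
  moreover have "norm (x - f x *\<^sub>R u) \<le> norm x" for x
    using numerically_positive_projection_complement_contractive[of P x] P(2,4) by (simp add: f)
  ultimately show ?thesis by (rule that)
qed

section \<open>Convex functions with a common logarithmic subderivative\<close>

text \<open>The bound for \<open>h1\<close> is used from \<open>s\<close> to \<open>t\<close>, the
  one for \<open>h2\<close> backwards from \<open>t\<close> to \<open>s\<close>. Adding their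
  logarithms leaves the difference of the two values of \<open>k\<close>, up to two errors from
  \<open>ln (1 + x) = x + O(x^2)\<close>, each at most \<open>2 C^2 (t - s)^2\<close>.\<close>

lemma log_ratio_step:
  fixes h1 h2 k :: "real \<Rightarrow> real"
  assumes pos: "\<And>s. h1 s > 0" "\<And>s. h2 s > 0"
    and h1: "\<And>s t. h1 s * (1 - k s * (t - s)) \<le> h1 t"
    and h2: "\<And>s t. h2 s * (1 - k s * (t - s)) \<le> h2 t"
    and k: "\<And>s. \<bar>k s\<bar> \<le> C" and small: "C * \<bar>t - s\<bar> \<le> 1/2"
  shows "ln (h1 t) - ln (h2 t) - (ln (h1 s) - ln (h2 s))
    \<ge> (k t - k s) * (t - s) - 4 * C\<^sup>2 * (t - s)\<^sup>2"
proof -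
  have b: "\<bar>k r * (t - s)\<bar> \<le> C * \<bar>t - s\<bar>" for r
    unfolding abs_mult by (intro mult_right_mono k) auto
  have sq: "(k r * (t - s))\<^sup>2 \<le> C\<^sup>2 * (t - s)\<^sup>2" for r
    using power_mono[OF b[of r], of 2] by (simp add: power_mult_distrib)
  have half: "\<bar>k r * (t - s)\<bar> \<le> 1/2" for r
    using b[of r] small by linarith
  have p1: "1 + - (k s * (t - s)) > 0" and p2: "1 + k t * (t - s) > 0"
    using half[of s] half[of t] by linarith+
  have "ln (h1 s) + ln (1 + - (k s * (t - s))) = ln (h1 s * (1 - k s * (t - s)))"
    using pos(1)[of s] p1 by (simp add: ln_mult)
  also have "\<dots> \<le> ln (h1 t)"
    using h1[of s t] pos(1)[of s] p1 pos(1)[of t] by (subst ln_le_cancel_iff) (auto intro: mult_pos_pos)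
  finally have A: "ln (h1 s) + ln (1 + - (k s * (t - s))) \<le> ln (h1 t)" .
  have e: "1 - k t * (s - t) = 1 + k t * (t - s)" by (simp add: algebra_simps)
  have "ln (h2 t) + ln (1 + k t * (t - s)) = ln (h2 t * (1 - k t * (s - t)))"
    using ln_mult_pos[OF pos(2)[of t] p2] by (simp only: e)
  also have "\<dots> \<le> ln (h2 s)"
    using h2[of t s] mult_pos_pos[OF pos(2)[of t] p2] pos(2)[of s] unfolding e
    by (subst ln_le_cancel_iff) auto
  finally have B: "ln (h2 t) + ln (1 + k t * (t - s)) \<le> ln (h2 s)" .
  have "\<bar>ln (1 + - (k s * (t - s))) - - (k s * (t - s))\<bar> \<le> 2 * (- (k s * (t - s)))\<^sup>2"
    by (rule abs_ln_one_plus_x_minus_x_bound) (use half[of s] in simp)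
  moreover have "\<bar>ln (1 + k t * (t - s)) - k t * (t - s)\<bar> \<le> 2 * (k t * (t - s))\<^sup>2"
    by (rule abs_ln_one_plus_x_minus_x_bound) (use half[of t] in simp)
  moreover have "(k t - k s) * (t - s) = k t * (t - s) - k s * (t - s)"
    by (simp add: algebra_simps)
  ultimately show ?thesis
    using A B sq[of s] sq[of t] by simp
qed

text \<open>The hypothesis says that both functions are convex and that \<open>- k s\<close> is a common logarithmic
  subderivative. Subdividing an interval into \<open>n\<close> pieces, the first-order errors of the log ratio
  telescope, so the total error is \<open>O(1/n)\<close>.\<close>

lemma common_log_subderivative_imp_proportional:
  fixes h1 h2 k :: "real \<Rightarrow> real"
  assumes pos: "\<And>s. h1 s > 0" "\<And>s. h2 s > 0"
    and h1: "\<And>s t. h1 s * (1 - k s * (t - s)) \<le> h1 t"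
    and h2: "\<And>s t. h2 s * (1 - k s * (t - s)) \<le> h2 t"
    and k: "\<And>s. \<bar>k s\<bar> \<le> C"
  shows "h1 a / h2 a = h1 b / h2 b"
proof -
  define W where "W s = ln (h1 s) - ln (h2 s)" for s
  \<comment> \<open>No order between \<open>a\<close> and \<open>b\<close> is assumed, so exchanging
    them yields equality.\<close>
  have mono: "W a \<le> W b" for a b
  proof -
    \<comment> \<open>The first term bounds the telescoped sum \<open>(k b - k a) * d\<close>, the
      second the \<open>n\<close> quadratic errors; both are \<open>O(1/n)\<close> for step length
      \<open>d = (b - a) / n\<close>. The condition on \<open>n\<close> makes each step short enough
      for \<open>log_ratio_step\<close>.\<close>
    define D where "D = 2 * C * \<bar>b - a\<bar> + 4 * C\<^sup>2 * (b - a)\<^sup>2"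
    have bound: "W b - W a \<ge> - D / real n" if n: "n > 0" "real n \<ge> 2 * C * \<bar>b - a\<bar>" for n
    proof -
      define d where "d = (b - a) / real n"
      have small: "C * \<bar>d\<bar> \<le> 1/2"
        using n unfolding d_def by (simp add: abs_divide field_simps)
      have "W (a + real i * d) - W a \<ge> (k (a + real i * d) - k a) * d - real i * (4 * C\<^sup>2 * d\<^sup>2)" for i
      proof (induction i)
        case (Suc i)
        have "(a + real (Suc i) * d) - (a + real i * d) = d" by (simp add: algebra_simps)
        then have "W (a + real (Suc i) * d) - W (a + real i * d)
            \<ge> (k (a + real (Suc i) * d) - k (a + real i * d)) * d - 4 * C\<^sup>2 * d\<^sup>2"
          using log_ratio_step[OF pos h1 h2 k, of "a + real (Suc i) * d" "a + real i * d"] small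
          unfolding W_def by simp
        with Suc show ?case by (simp add: algebra_simps)
      qed simp
      from this[of n] have "W b - W a \<ge> (k b - k a) * d - real n * (4 * C\<^sup>2 * d\<^sup>2)"
        using n by (simp add: d_def)
      moreover have "real n * (4 * C\<^sup>2 * d\<^sup>2) = 4 * C\<^sup>2 * (b - a)\<^sup>2 / real n"
        using n by (simp add: d_def power2_eq_square field_simps)
      moreover have "(k b - k a) * d \<ge> - (2 * C * \<bar>b - a\<bar> / real n)"
      proof -
        have "\<bar>(k b - k a) * d\<bar> \<le> (2 * C) * \<bar>d\<bar>"
          unfolding abs_mult using k[of a] k[of b] by (intro mult_right_mono) auto
        also have "\<dots> = 2 * C * \<bar>b - a\<bar> / real n" by (simp add: d_def abs_divide)
        finally show ?thesis by linarith
      qed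
      moreover have "- D / real n = - (2 * C * \<bar>b - a\<bar> / real n) - 4 * C\<^sup>2 * (b - a)\<^sup>2 / real n"
        unfolding D_def by (simp add: diff_divide_distrib add_divide_distrib)
      ultimately show ?thesis by linarith
    qed
    have "(\<lambda>n. - D / real n) \<longlonglongrightarrow> 0"
      by (rule lim_const_over_n)
    moreover have "\<forall>\<^sub>F n in sequentially. - D / real n \<le> W b - W a"
      using eventually_gt_at_top[of 0] eventually_ge_at_top[of "nat \<lceil>2 * C * \<bar>b - a\<bar>\<rceil>"]
      by eventually_elim (rule bound, auto simp: ceiling_le_iff nat_le_iff)
    ultimately have "0 \<le> W b - W a"
      by (intro tendsto_upperbound[of _ 0 sequentially]) auto
    then show ?thesis by simp
  qed
  have "W a = W b" using mono[of a b] mono[of b a] by simp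
  then have "ln (h1 a / h2 a) = ln (h1 b / h2 b)"
    by (simp add: W_def ln_divide_pos pos)
  then show ?thesis by (subst (asm) ln_inj_iff) (simp_all add: pos)
qed

section \<open>Three-dimensional norms\<close>

text \<open>Expanding the triple product shows that \<open>d\<close> has zero cross product with
  \<open>cross3 a b\<close>, so the two are parallel.\<close>

lemma orthogonal_complement_pair3:
  fixes a b d :: "real^3"
  assumes "d \<bullet> a = 0" "d \<bullet> b = 0" "cross3 a b \<noteq> 0"
  obtains c where "d = c *\<^sub>R cross3 a b"
proof -
  define n where "n = cross3 a b"
  define c where "c = (d \<bullet> n) / (n \<bullet> n)"
  have "n \<bullet> n \<noteq> 0" using assms(3) by (simp add: n_def)
  then have "n \<bullet> d = n \<bullet> (c *\<^sub>R n)" by (simp add: c_def inner_commute)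
  moreover have "cross3 n d = cross3 n (c *\<^sub>R n)"
  proof -
    have "cross3 d n = 0" unfolding n_def Lagrange by (simp add: assms)
    then show ?thesis by (simp add: cross_skew[of n d] cross_mult_right)
  qed
  moreover have "n \<noteq> 0" using assms(3) by (simp add: n_def)
  ultimately have "d = c *\<^sub>R n" by (rule cross_dot_cancel)
  then show ?thesis unfolding n_def by (rule that)
qed

lemma cross3_orthogonal_nonzero:
  fixes a b :: "real^3"
  assumes "a \<bullet> b = 0" "a \<noteq> 0" "b \<noteq> 0"
  shows "cross3 a b \<noteq> 0"
  using norm_cross_dot[of a b] assms by auto

lemma plane_orthonormal_basis3:
  fixes G e1 :: "real^3"
  assumes "G \<noteq> 0" "G \<bullet> e1 = 0" "norm e1 = 1"
  obtains e0 where "norm e0 = 1" "G \<bullet> e0 = 0" "e0 \<bullet> e1 = 0"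
    "\<And>x. G \<bullet> x = 0 \<Longrightarrow> x = (x \<bullet> e0) *\<^sub>R e0 + (x \<bullet> e1) *\<^sub>R e1"
proof -
  define m where "m = cross3 G e1"
  define e0 where "e0 = m /\<^sub>R norm m"
  have e1: "e1 \<noteq> 0" using assms(3) by auto
  have m: "m \<noteq> 0" unfolding m_def using cross3_orthogonal_nonzero[OF assms(2,1) e1] .
  have n0: "norm e0 = 1" using m by (simp add: e0_def)
  have G0: "G \<bullet> e0 = 0" and e01: "e0 \<bullet> e1 = 0"
    by (simp_all add: e0_def m_def dot_cross_self)
  have inner1: "e0 \<bullet> e0 = 1" "e1 \<bullet> e1 = 1" using n0 assms(3) by (simp_all add: norm_eq_1)
  have "x = (x \<bullet> e0) *\<^sub>R e0 + (x \<bullet> e1) *\<^sub>R e1" if x: "G \<bullet> x = 0" for x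
  proof -
    define d where "d = x - (x \<bullet> e0) *\<^sub>R e0 - (x \<bullet> e1) *\<^sub>R e1"
    have dG: "d \<bullet> G = 0" and d1: "d \<bullet> e1 = 0" and d0: "d \<bullet> e0 = 0"
      using x G0 assms(2) e01 inner1
      by (simp_all add: d_def inner_diff_left inner_commute[of _ G] inner_diff_right inner_commute[of e1 e0])
    obtain c where c: "d = c *\<^sub>R m"
      using orthogonal_complement_pair3[OF dG d1] m by (auto simp: m_def)
    with m have "d = (c * norm m) *\<^sub>R e0" by (simp add: e0_def)
    with d0 inner1 have "d = 0" by simp
    then show ?thesis by (simp add: d_def algebra_simps)
  qed
  with n0 G0 e01 show ?thesis by (rule that)
qed

text \<open>\<open>F u\<close> represents the functional \<open>f\<^sub>u\<close> by the inner product of \<open>\<real>\<^sup>3\<close>.\<close>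

locale flinn_norm3 =
  fixes N :: "real^3 \<Rightarrow> real" and F :: "real^3 \<Rightarrow> real^3"
  assumes N_zero_iff: "N x = 0 \<longleftrightarrow> x = 0"
    and N_scaleR: "N (c *\<^sub>R x) = \<bar>c\<bar> * N x"
    and N_triangle: "N (x + y) \<le> N x + N y"
    and F_self: "u \<noteq> 0 \<Longrightarrow> F u \<bullet> u = 1"
    and F_contraction: "u \<noteq> 0 \<Longrightarrow> N (x - (F u \<bullet> x) *\<^sub>R u) \<le> N x"
begin

lemma N_minus [simp]: "N (- x) = N x"
  using N_scaleR[of "- 1" x] by simp

lemma N_zero [simp]: "N 0 = 0"
  by (simp add: N_zero_iff)

lemma N_nonneg: "N x \<ge> 0"
  using N_triangle[of x "- x"] by simp

lemma N_pos: "x \<noteq> 0 \<Longrightarrow> N x > 0"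
  using N_nonneg[of x] N_zero_iff[of x] by linarith

lemma N_triangle_diff: "N (x - y) \<le> N x + N y"
  using N_triangle[of x "- y"] by simp

lemma convex_on_N: "convex_on UNIV N"
proof (rule convex_onI)
  fix t x y assume "(0::real) < t" "t < 1"
  then show "N ((1 - t) *\<^sub>R x + t *\<^sub>R y) \<le> (1 - t) * N x + t * N y"
    using N_triangle[of "(1 - t) *\<^sub>R x" "t *\<^sub>R y"] by (simp add: N_scaleR)
qed simp

lemma continuous_on_N: "continuous_on S N"
  using convex_on_continuous[OF open_UNIV convex_on_N] continuous_on_subset by blast

lemma N_ge_norm:
  obtains m where "m > 0" "\<And>x. m * norm x \<le> N x"
proof -
  obtain y where y: "y \<in> sphere 0 1" "\<And>x. x \<in> sphere 0 1 \<Longrightarrow> N y \<le> N x"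
    using continuous_attains_inf[OF compact_sphere _ continuous_on_N, of 0 1] by auto
  have "y \<noteq> 0" using y(1) by auto
  then have "N y > 0" by (rule N_pos)
  moreover have "N y * norm x \<le> N x" for x
  proof (cases "x = 0")
    case False
    have "N y \<le> N (x /\<^sub>R norm x)" using False by (intro y(2)) simp
    then show ?thesis using False by (simp add: N_scaleR field_simps)
  qed simp
  ultimately show ?thesis by (rule that)
qed

text \<open>The component along \<open>u\<close> is the difference of \<open>x\<close> and its
  contracted image. This gives both the compactness needed for limits of functionals and the bound
  on \<open>k\<close> below.\<close>

lemma F_bound:
  assumes "u \<noteq> 0"
  shows "\<bar>F u \<bullet> x\<bar> * N u \<le> 2 * N x"
proof -
  have "N ((F u \<bullet> x) *\<^sub>R u) = N (x - (x - (F u \<bullet> x) *\<^sub>R u))" by simp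
  also have "\<dots> \<le> N x + N (x - (F u \<bullet> x) *\<^sub>R u)" by (rule N_triangle_diff)
  finally show ?thesis using F_contraction[OF assms, of x] by (simp add: N_scaleR)
qed

text \<open>\<open>F\<close> need not be continuous. However, \<open>F_bound\<close> keeps its
  values bounded near \<open>u\<close>, so a subsequence converges, and the contraction property is
  closed under limits.\<close>

lemma F_cluster_point:
  assumes lim: "U \<longlonglongrightarrow> u" and u: "u \<noteq> 0" and U: "\<And>n. U n \<noteq> 0"
  obtains r f where "strict_mono r" "(\<lambda>n. F (U (r n))) \<longlonglongrightarrow> f"
    "f \<bullet> u = 1" "\<And>x. N (x - (f \<bullet> x) *\<^sub>R u) \<le> N x"
proof -
  have contN: "(\<lambda>n. N (X n)) \<longlonglongrightarrow> N x" if "X \<longlonglongrightarrow> x" for X x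
    using continuous_on_N[of UNIV] that
    by (intro isCont_tendsto_compose[of x N]) (auto simp: continuous_on_eq_continuous_at)
  have "\<forall>\<^sub>F n in sequentially. N (U n) > N u / 2"
    using N_pos[OF u] by (intro order_tendstoD(1)[OF contN[OF lim]]) simp
  then obtain n0 where n0: "\<And>n. n \<ge> n0 \<Longrightarrow> N (U n) > N u / 2"
    by (auto simp: eventually_sequentially)
  \<comment> \<open>Coordinates are values on axis vectors; the 4 is the 2 of \<open>F_bound\<close>
    doubled by \<open>N (U n) > N u / 2\<close>.\<close>
  define B where "B i = 4 * N (axis i 1) / N u" for i :: 3
  have "norm (F (U (n + n0))) \<le> (\<Sum>i\<in>UNIV. B i)" for n
  proof -
    have "\<bar>F (U (n + n0)) $ i\<bar> \<le> B i" for i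
    proof -
      have "\<bar>F (U (n + n0)) $ i\<bar> * (N u / 2) \<le> \<bar>F (U (n + n0)) $ i\<bar> * N (U (n + n0))"
        using n0[of "n + n0"] by (intro mult_left_mono) auto
      also have "\<dots> \<le> 2 * N (axis i 1)"
        using F_bound[OF U[of "n + n0"], of "axis i 1"] by (simp add: inner_axis)
      finally show ?thesis unfolding B_def using N_pos[OF u] by (simp add: field_simps)
    qed
    then show ?thesis using norm_le_l1_cart[of "F (U (n + n0))"] by (meson order_trans sum_mono)
  qed
  then have "bounded (range (\<lambda>n. F (U (n + n0))))" by (auto simp: bounded_iff)
  from bounded_imp_convergent_subsequence[OF this] obtain f r where
    r: "strict_mono r" "((\<lambda>n. F (U (n + n0))) \<circ> r) \<longlonglongrightarrow> f" by auto
  define r' where "r' n = r n + n0" for n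
  have r': "strict_mono r'" using r(1) by (auto simp: r'_def strict_mono_def)
  have f: "(\<lambda>n. F (U (r' n))) \<longlonglongrightarrow> f" using r(2) by (simp add: r'_def o_def)
  have lim': "(\<lambda>n. U (r' n)) \<longlonglongrightarrow> u" using LIMSEQ_subseq_LIMSEQ[OF lim r'] by (simp add: o_def)
  have "(\<lambda>n. F (U (r' n)) \<bullet> U (r' n)) \<longlonglongrightarrow> f \<bullet> u" by (intro tendsto_inner f lim')
  then have "f \<bullet> u = 1" by (simp add: F_self[OF U] LIMSEQ_const_iff)
  moreover have "N (x - (f \<bullet> x) *\<^sub>R u) \<le> N x" for x
  proof (rule LIMSEQ_le_const2)
    show "(\<lambda>n. N (x - (F (U (r' n)) \<bullet> x) *\<^sub>R U (r' n))) \<longlonglongrightarrow> N (x - (f \<bullet> x) *\<^sub>R u)"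
      by (intro contN tendsto_intros f lim')
  qed (use F_contraction[OF U] in auto)
  ultimately show ?thesis using that[OF r' f] by blast
qed

end

section \<open>Faces of the unit ball\<close>

locale flinn_norm3_support = flinn_norm3 +
  fixes G :: "real^3"
  assumes G_le: "G \<bullet> x \<le> N x"
begin

definition face :: "(real^3) set" where
  "face = {x. G \<bullet> x = 1 \<and> N x \<le> 1}"

lemma compact_face: "compact face"
proof -
  obtain m where m: "m > 0" "\<And>x. m * norm x \<le> N x" using N_ge_norm by blast
  have "bounded face"
  proof (rule boundedI)
    fix x assume "x \<in> face"
    then have "m * norm x \<le> 1" using m(2)[of x] by (simp add: face_def)
    then show "norm x \<le> 1 / m" using m(1) by (simp add: field_simps)
  qed
  moreover have "closed face"
    unfolding face_def by (intro closed_Collect_conj closed_Collect_eq closed_Collect_le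
        continuous_intros continuous_on_N)
  ultimately show ?thesis by (simp add: compact_eq_bounded_closed)
qed

lemma face_shift:
  assumes "x \<in> face" "G \<bullet> u = 0" "N (x - (f \<bullet> x) *\<^sub>R u) \<le> N x"
  shows "x - (f \<bullet> x) *\<^sub>R u \<in> face"
  using assms by (auto simp: face_def inner_diff_right)

text \<open>The contracted image of a face point stays in the unit ball, where \<open>G\<close> is
  at most 1, while \<open>G\<close> equals 1 at the point itself.\<close>

lemma F_face_sign:
  assumes "x \<in> face" "u \<noteq> 0"
  shows "(F u \<bullet> x) * (G \<bullet> u) \<ge> 0"
  using G_le[of "x - (F u \<bullet> x) *\<^sub>R u"] F_contraction[OF assms(2), of x] assms(1)
  by (simp add: face_def inner_diff_right)

text \<open>Let \<open>p, q\<close> be at maximal Euclidean distance in the face and \<open>u \<perp> p - q\<close> a direction of the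
  face. Shifting \<open>p\<close> or \<open>q\<close> along \<open>u\<close> leaves the face, so a contracting functional for \<open>u\<close>
  vanishes at \<open>p\<close> and \<open>q\<close> and is thereby determined. Tilting \<open>u\<close> slightly to either side of the face
  produces, in the limit, one such functional that is \<open>\<ge> 0\<close> and one that is \<open>\<le> 0\<close> on the face.\<close>

lemma face_not_two_dimensional:
  assumes v: "v \<in> face" and a: "v + a \<in> face" and b: "v + b \<in> face"
  shows "cross3 a b = 0"
proof (rule ccontr)
  assume ab: "cross3 a b \<noteq> 0"
  have Gv: "G \<bullet> v = 1" and Ga: "G \<bullet> a = 0" and Gb: "G \<bullet> b = 0"
    using v a b by (auto simp: face_def inner_add_right)
  have G0: "G \<noteq> 0" using Gv by auto
  obtain p q where p: "p \<in> face" and q: "q \<in> face" and pq: "dist p q = diameter face"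
    using diameter_compact_attained[OF compact_face] v by blast
  have dist_le: "dist x y \<le> dist p q" if "x \<in> face" "y \<in> face" for x y
    unfolding pq using that compact_face by (intro diameter_bounded_bound compact_imp_bounded)
  define \<tau> where "\<tau> = p - q"
  have "a \<noteq> 0" using ab by auto
  then have "dist (v + a) v > 0" by simp
  then have "p \<noteq> q" using dist_le[OF a v] by auto
  then have \<tau>: "\<tau> \<noteq> 0" by (simp add: \<tau>_def)
  have G\<tau>: "G \<bullet> \<tau> = 0" using p q by (simp add: \<tau>_def face_def inner_diff_right)
  define u where "u = cross3 G \<tau>"
  have u0: "u \<noteq> 0" unfolding u_def using cross3_orthogonal_nonzero[OF G\<tau> G0 \<tau>] .
  have Gu: "G \<bullet> u = 0" and \<tau>u: "\<tau> \<bullet> u = 0" by (simp_all add: u_def dot_cross_self)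
  have vanish: "f \<bullet> p = 0 \<and> f \<bullet> q = 0" if f: "\<And>x. N (x - (f \<bullet> x) *\<^sub>R u) \<le> N x" for f
  proof -
    have "c = 0" if "dist (p - c *\<^sub>R u) q \<le> dist p q" for c
    proof -
      have "(norm (\<tau> - c *\<^sub>R u))\<^sup>2 \<le> (norm \<tau>)\<^sup>2"
        using that by (intro power_mono) (auto simp: dist_norm \<tau>_def algebra_simps)
      then have "c\<^sup>2 * (norm u)\<^sup>2 \<le> 0"
        unfolding power2_norm_eq_inner using \<tau>u
        by (simp add: inner_diff_left inner_diff_right inner_commute[of u \<tau>] power2_eq_square)
      then show ?thesis using u0 by (simp add: mult_le_0_iff)
    qed
    moreover have "c = 0" if "dist p (q - c *\<^sub>R u) \<le> dist p q" for c
    proof -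
      have "(norm (\<tau> + c *\<^sub>R u))\<^sup>2 \<le> (norm \<tau>)\<^sup>2"
        using that by (intro power_mono) (auto simp: dist_norm \<tau>_def algebra_simps)
      then have "c\<^sup>2 * (norm u)\<^sup>2 \<le> 0"
        unfolding power2_norm_eq_inner using \<tau>u
        by (simp add: inner_add_left inner_add_right inner_commute[of u \<tau>] power2_eq_square)
      then show ?thesis using u0 by (simp add: mult_le_0_iff)
    qed
    ultimately show ?thesis
      using dist_le[OF face_shift[OF p Gu f] q] dist_le[OF p face_shift[OF q Gu f]] by blast
  qed
  have limit: "\<exists>f. f \<bullet> u = 1 \<and> (\<forall>x. N (x - (f \<bullet> x) *\<^sub>R u) \<le> N x) \<and> (\<forall>x\<in>face. \<sigma> * (f \<bullet> x) \<ge> 0)"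
    if \<sigma>: "\<sigma> \<noteq> 0" for \<sigma> :: real
  proof -
    \<comment> \<open>The tilt gives \<open>G \<bullet> U n\<close> the sign of \<sigma>, so
      \<open>F_face_sign\<close> controls the sign of the functionals on the whole face and this
      sign survives in the limit.\<close>
    define U where "U n = u + (\<sigma> / real (Suc n)) *\<^sub>R v" for n
    have GU: "G \<bullet> U n = \<sigma> / real (Suc n)" for n
      by (simp add: U_def inner_add_right Gu Gv)
    have U0: "U n \<noteq> 0" for n using GU[of n] \<sigma> by auto
    have "(\<lambda>n. \<sigma> / real (Suc n)) \<longlonglongrightarrow> 0"
      using LIMSEQ_Suc[OF lim_const_over_n[of \<sigma>]] by simp
    then have "U \<longlonglongrightarrow> u + 0 *\<^sub>R v" unfolding U_def by (intro tendsto_intros)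
    then have lim: "U \<longlonglongrightarrow> u" by simp
    obtain r f where rf: "strict_mono r" "(\<lambda>n. F (U (r n))) \<longlonglongrightarrow> f"
      "f \<bullet> u = 1" "\<And>x. N (x - (f \<bullet> x) *\<^sub>R u) \<le> N x"
      using F_cluster_point[OF lim u0 U0] by blast
    have "\<sigma> * (f \<bullet> x) \<ge> 0" if x: "x \<in> face" for x
    proof (rule LIMSEQ_le_const)
      show "(\<lambda>n. \<sigma> * (F (U (r n)) \<bullet> x)) \<longlonglongrightarrow> \<sigma> * (f \<bullet> x)" by (intro tendsto_intros rf(2))
      show "\<exists>M. \<forall>n\<ge>M. 0 \<le> \<sigma> * (F (U (r n)) \<bullet> x)"
        using F_face_sign[OF x U0] by (auto simp: GU zero_le_divide_iff mult.commute)
    qed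
    with rf(3,4) show ?thesis by blast
  qed
  obtain f where f: "f \<bullet> u = 1" "\<And>x. N (x - (f \<bullet> x) *\<^sub>R u) \<le> N x" "\<And>x. x \<in> face \<Longrightarrow> f \<bullet> x \<ge> 0"
    using limit[of 1] by auto
  obtain g where g: "g \<bullet> u = 1" "\<And>x. N (x - (g \<bullet> x) *\<^sub>R u) \<le> N x" "\<And>x. x \<in> face \<Longrightarrow> g \<bullet> x \<le> 0"
    using limit[of "- 1"] by auto
  \<comment> \<open>The difference vanishes on the directions \<open>u\<close> and \<tau> of
    \<open>ker G\<close>, hence is a multiple of \<open>G\<close>; it also vanishes at
    \<open>p\<close>, where \<open>G\<close> is 1.\<close>
  have "f = g"
  proof -
    have d: "(f - g) \<bullet> u = 0" "(f - g) \<bullet> \<tau> = 0" "(f - g) \<bullet> p = 0"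
      using vanish[OF f(2)] vanish[OF g(2)] f(1) g(1)
      by (auto simp: inner_diff_left inner_diff_right \<tau>_def)
    have nz: "cross3 \<tau> u \<noteq> 0" using cross3_orthogonal_nonzero[OF \<tau>u \<tau> u0] .
    obtain c where c: "f - g = c *\<^sub>R cross3 \<tau> u"
      using orthogonal_complement_pair3[OF d(2,1) nz] by blast
    obtain c' where c': "G = c' *\<^sub>R cross3 \<tau> u"
      using orthogonal_complement_pair3[OF G\<tau> Gu nz] by blast
    have "G \<bullet> p = 1" using p by (simp add: face_def)
    then have "cross3 \<tau> u \<bullet> p \<noteq> 0" using c' by auto
    then show ?thesis using d(3) c by simp
  qed
  \<comment> \<open>Being both nonnegative and nonpositive, \<open>f\<close> vanishes on the face.
    Since \<open>v\<close>, \<open>a\<close>, \<open>b\<close> span the space, this forces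
    \<open>f = 0\<close>, against \<open>f \<bullet> u = 1\<close>.\<close>
  then have zero: "f \<bullet> x = 0" if "x \<in> face" for x using f(3) g(3) that by (metis order_antisym)
  have fa: "f \<bullet> a = 0" and fb: "f \<bullet> b = 0" and fv: "f \<bullet> v = 0"
    using zero[OF v] zero[OF a] zero[OF b] by (auto simp: inner_add_right)
  obtain c where c: "f = c *\<^sub>R cross3 a b" using orthogonal_complement_pair3[OF fa fb ab] by blast
  obtain c' where c': "G = c' *\<^sub>R cross3 a b" using orthogonal_complement_pair3[OF Ga Gb ab] by blast
  have "cross3 a b \<bullet> v \<noteq> 0" using c' Gv by auto
  then have "f = 0" using fv c by simp
  then show False using f(1) by simp
qed

text \<open>Contracting \<open>v\<close> along a direction of \<open>ker G\<close> moves it inside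
  the face. Nonzero moves in two independent directions would make the face two-dimensional.\<close>

lemma exceptional_direction:
  assumes v: "v \<in> face"
  obtains e where "norm e = 1" "G \<bullet> e = 0"
    "\<And>u. G \<bullet> u = 0 \<Longrightarrow> cross3 e u \<noteq> 0 \<Longrightarrow> F u \<bullet> v = 0"
proof (cases "\<exists>w. w \<noteq> 0 \<and> G \<bullet> w = 0 \<and> F w \<bullet> v \<noteq> 0")
  case True
  then obtain w where w: "w \<noteq> 0" "G \<bullet> w = 0" "F w \<bullet> v \<noteq> 0" by blast
  show ?thesis
  proof (rule that)
    show "norm (w /\<^sub>R norm w) = 1" "G \<bullet> (w /\<^sub>R norm w) = 0" using w by simp_all
    fix u assume u: "G \<bullet> u = 0" "cross3 (w /\<^sub>R norm w) u \<noteq> 0"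
    then have "u \<noteq> 0" and wu: "cross3 w u \<noteq> 0" by (auto simp: cross_mult_left)
    have "v + - (F w \<bullet> v) *\<^sub>R w \<in> face" "v + - (F u \<bullet> v) *\<^sub>R u \<in> face"
      using face_shift[OF v w(2) F_contraction[OF w(1)]]
        face_shift[OF v u(1) F_contraction[OF \<open>u \<noteq> 0\<close>]] by simp_all
    from face_not_two_dimensional[OF v this] show "F u \<bullet> v = 0"
      using w(3) wu by (simp add: cross_mult_left cross_mult_right)
  qed
next
  \<comment> \<open>Without an exceptional direction any unit vector of \<open>ker G\<close>
    serves.\<close>
  case False
  have "G \<noteq> 0" using v by (auto simp: face_def)
  then obtain b where b: "cross3 G b \<noteq> 0" using cross_basis_nonzero by blast
  define e where "e = cross3 G b /\<^sub>R norm (cross3 G b)"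
  have "norm e = 1" "G \<bullet> e = 0" using b by (simp_all add: e_def dot_cross_self)
  moreover have "F u \<bullet> v = 0" if "G \<bullet> u = 0" "cross3 e u \<noteq> 0" for u
    using False that by auto
  ultimately show ?thesis by (rule that)
qed

text \<open>With \<open>r > 1\<close> the section contains a neighbourhood of 0 in
  \<open>ker G\<close>, so its support function \<open>H\<close> is positive and logarithmic
  derivatives make sense. The functions compared are \<open>H\<close> and its reflection.\<close>

lemma section_symmetric:
  assumes v: "v \<in> face" and r: "r > 1" and x: "G \<bullet> x = 0" "N (v + x) \<le> r"
  shows "N (v - x) \<le> r"
proof (rule ccontr)
  assume not: "\<not> N (v - x) \<le> r"
  obtain e1 where e1: "norm e1 = 1" "G \<bullet> e1 = 0"
    and exc: "\<And>u. G \<bullet> u = 0 \<Longrightarrow> cross3 e1 u \<noteq> 0 \<Longrightarrow> F u \<bullet> v = 0"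
    using exceptional_direction[OF v] by blast
  have Gv: "G \<bullet> v = 1" and Nv: "N v \<le> 1" using v by (auto simp: face_def)
  have G0: "G \<noteq> 0" using Gv by auto
  obtain e0 where e0: "norm e0 = 1" "G \<bullet> e0 = 0" "e0 \<bullet> e1 = 0"
    and basis: "\<And>x. G \<bullet> x = 0 \<Longrightarrow> x = (x \<bullet> e0) *\<^sub>R e0 + (x \<bullet> e1) *\<^sub>R e1"
    using plane_orthonormal_basis3[OF G0 e1(2,1)] by blast
  have ip: "e0 \<bullet> e0 = 1" "e1 \<bullet> e1 = 1" "e1 \<bullet> e0 = 0"
    using e0 e1 by (auto simp: norm_eq_1 inner_commute)
  obtain m where m: "m > 0" "\<And>x. m * norm x \<le> N x" using N_ge_norm by blast

  define K where "K = {x. G \<bullet> x = 0 \<and> N (v + x) \<le> r}"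
  define D where "D = (r + 1) / m"
  have D: "norm y \<le> D" if "y \<in> K" for y
  proof -
    have "m * norm y \<le> N ((v + y) - v)" using m(2)[of y] by simp
    also have "\<dots> \<le> r + 1" using N_triangle_diff[of "v + y" v] that Nv by (simp add: K_def)
    finally show ?thesis using m(1) by (simp add: D_def field_simps)
  qed
  have K0: "0 \<in> K" using Nv r by (simp add: K_def)
  have D0: "D \<ge> 0" using D[OF K0] by simp
  define H where "H n = Sup ((\<lambda>y. n \<bullet> y) ` K)" for n
  have bdd: "bdd_above ((\<lambda>y. n \<bullet> y) ` K)" for n
  proof (rule bdd_aboveI2)
    fix y assume "y \<in> K"
    have "n \<bullet> y \<le> norm n * norm y" by (rule norm_cauchy_schwarz)
    also have "\<dots> \<le> norm n * D" using D[OF \<open>y \<in> K\<close>] by (intro mult_left_mono) auto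
    finally show "n \<bullet> y \<le> norm n * D" .
  qed
  have H_ge: "n \<bullet> y \<le> H n" if "y \<in> K" for n y
    unfolding H_def using that by (intro cSUP_upper bdd)
  have H_le: "H n \<le> c" if "\<And>y. y \<in> K \<Longrightarrow> n \<bullet> y \<le> c" for n c
    unfolding H_def using that K0 by (intro cSUP_least) auto
  have H_scale: "H (c *\<^sub>R n) = c * H n" if c: "c > 0" for c n
  proof (rule antisym)
    show "H (c *\<^sub>R n) \<le> c * H n" using c H_ge by (intro H_le) simp
    have "H n \<le> H (c *\<^sub>R n) / c"
      using c H_ge[of _ "c *\<^sub>R n"] by (intro H_le) (simp add: field_simps)
    then show "c * H n \<le> H (c *\<^sub>R n)" using c by (simp add: field_simps)
  qed
  have H_lip: "H n - H n' \<le> D * dist n n'" for n n'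
  proof -
    have "H n \<le> H n' + D * dist n n'"
    proof (rule H_le)
      fix y assume y: "y \<in> K"
      have "(n - n') \<bullet> y \<le> norm (n - n') * norm y" by (rule norm_cauchy_schwarz)
      also have "\<dots> \<le> norm (n - n') * D" using D[OF y] by (intro mult_left_mono) auto
      finally show "n \<bullet> y \<le> H n' + D * dist n n'"
        using H_ge[OF y, of n'] by (simp add: inner_diff_left dist_norm mult.commute)
    qed
    then show ?thesis by simp
  qed
  have H_cont: "continuous_on UNIV H"
  proof (rule lipschitz_on_continuous_on)
    show "D-lipschitz_on UNIV H"
    proof (rule lipschitz_onI)
      show "dist (H n) (H n') \<le> D * dist n n'" for n n'
        using H_lip[of n n'] H_lip[of n' n] by (simp add: dist_real_def dist_commute abs_le_iff)
    qed (rule D0)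
  qed
  have H_pos: "H n > 0" if n: "n \<noteq> 0" "G \<bullet> n = 0" for n
  proof -
    define c where "c = (r - 1) / N n"
    have c: "c > 0" using r N_pos[OF n(1)] by (simp add: c_def)
    have "N (v + c *\<^sub>R n) \<le> 1 + c * N n"
      using N_triangle[of v "c *\<^sub>R n"] Nv c by (simp add: N_scaleR)
    also have "\<dots> = r" using N_pos[OF n(1)] by (simp add: c_def)
    finally have "c *\<^sub>R n \<in> K" using n by (simp add: K_def)
    then have "n \<bullet> (c *\<^sub>R n) \<le> H n" by (rule H_ge)
    moreover have "n \<bullet> (c *\<^sub>R n) > 0" using n(1) c by simp
    ultimately show ?thesis by simp
  qed

  \<comment> \<open>Up to scaling, \<open>u s\<close> runs through all directions of
    \<open>ker G\<close> except that of \<open>e1\<close>, the only possible exception to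
    \<open>F u \<bullet> v = 0\<close>; \<open>n s\<close> is normal to \<open>u s\<close>.\<close>
  define u where "u s = e0 - s *\<^sub>R e1" for s :: real
  define n where "n s = e1 + s *\<^sub>R e0" for s :: real
  define k where "k s = F (u s) \<bullet> e1" for s
  have Gu: "G \<bullet> u s = 0" and Gn: "G \<bullet> n s = 0" for s
    by (simp_all add: u_def n_def inner_diff_right inner_add_right e0 e1)
  have u_cross: "cross3 e1 (u s) \<noteq> 0" for s
  proof -
    have "cross3 e1 e0 \<noteq> 0" using e0 e1 ip by (intro cross3_orthogonal_nonzero) auto
    moreover have "cross3 e1 (u s) = cross3 e1 e0"
      unfolding u_def by (simp add: Cross3.right_diff_distrib cross_mult_right)
    ultimately show ?thesis by simp
  qed
  then have u_nz: "u s \<noteq> 0" for s by (metis cross_zero_right)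
  have Fuv: "F (u s) \<bullet> v = 0" for s using exc[OF Gu u_cross] .
  have n_nz: "n s \<noteq> 0" for s
  proof -
    have "n s \<bullet> e1 = 1" using ip e0 by (simp add: n_def inner_add_left)
    then show ?thesis by auto
  qed
  \<comment> \<open>As \<open>F (u s)\<close> kills \<open>v\<close>, the contraction of
    \<open>v + y\<close> is \<open>v\<close> plus that of \<open>y\<close>. The latter lies on a
    line through 0 and depends on \<open>y\<close> only through
    \<open>n s \<bullet> y\<close>.\<close>
  have shift: "(n s \<bullet> y) *\<^sub>R (e1 - k s *\<^sub>R u s) \<in> K" if y: "y \<in> K" for s y
  proof -
    define \<alpha> \<beta> where "\<alpha> = y \<bullet> e0" and "\<beta> = y \<bullet> e1"
    have y_eq: "y = \<alpha> *\<^sub>R e0 + \<beta> *\<^sub>R e1" using basis[of y] y by (simp add: K_def \<alpha>_def \<beta>_def)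
    have ny: "n s \<bullet> y = \<beta> + s * \<alpha>"
      by (simp add: n_def \<alpha>_def \<beta>_def inner_add_left inner_commute[of e0 y] inner_commute[of e1 y])
    have y_eq': "y = \<alpha> *\<^sub>R u s + (n s \<bullet> y) *\<^sub>R e1"
      unfolding ny by (subst y_eq) (simp add: u_def algebra_simps)
    have "F (u s) \<bullet> y = \<alpha> + (n s \<bullet> y) * k s"
      by (subst y_eq') (simp add: inner_add_right F_self[OF u_nz] k_def)
    then have "y - (F (u s) \<bullet> y) *\<^sub>R u s = (n s \<bullet> y) *\<^sub>R (e1 - k s *\<^sub>R u s)"
      by (subst (1) y_eq') (simp add: algebra_simps)
    moreover have "y - (F (u s) \<bullet> y) *\<^sub>R u s \<in> K"
      using y F_contraction[OF u_nz, of "v + y" s] Gu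
      by (simp add: K_def inner_diff_right inner_add_right Fuv algebra_simps)
    ultimately show ?thesis by simp
  qed
  have inner_shift: "n t \<bullet> (e1 - k s *\<^sub>R u s) = 1 - k s * (t - s)" for s t
    by (simp add: n_def u_def inner_add_left inner_diff_right ip e0 algebra_simps)
  \<comment> \<open>Testing the shifted points against \<open>n t\<close> bounds \<open>H\<close> at
    \<open>n t\<close> from below. The factor is the same for both signs \<sigma>, which makes
    \<open>- k s\<close> a common logarithmic subderivative.\<close>
  have step: "H (\<sigma> *\<^sub>R n s) * (1 - k s * (t - s)) \<le> H (\<sigma> *\<^sub>R n t)" if \<sigma>: "\<sigma> \<noteq> 0" for \<sigma> s t :: real
  proof -
    define \<phi> where "\<phi> = 1 - k s * (t - s)"
    have pos: "H (\<sigma> *\<^sub>R n r) > 0" for r using \<sigma> n_nz Gn by (intro H_pos) auto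
    show ?thesis
    proof (cases "\<phi> > 0")
      case True
      have "H (\<sigma> *\<^sub>R n s) \<le> H (\<sigma> *\<^sub>R n t) / \<phi>"
      proof (rule H_le)
        fix y assume "y \<in> K"
        from H_ge[OF shift[OF this], of "\<sigma> *\<^sub>R n t" s]
        have "\<sigma> * ((n s \<bullet> y) * \<phi>) \<le> H (\<sigma> *\<^sub>R n t)"
          by (simp add: inner_shift \<phi>_def mult_ac)
        then show "\<sigma> *\<^sub>R n s \<bullet> y \<le> H (\<sigma> *\<^sub>R n t) / \<phi>" using True by (simp add: field_simps)
      qed
      then show ?thesis unfolding \<phi>_def[symmetric] using True by (simp add: field_simps)
    next
      case False
      then have "H (\<sigma> *\<^sub>R n s) * \<phi> \<le> 0" using pos[of s] by (simp add: mult_le_0_iff)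
      then show ?thesis using pos[of t] by (simp add: \<phi>_def)
    qed
  qed
  have k_bound: "\<bar>k s\<bar> \<le> 2 * N e1 / m" for s
  proof -
    have "1 = u s \<bullet> e0" using ip by (simp add: u_def inner_diff_left)
    also have "\<dots> \<le> norm (u s)" using norm_cauchy_schwarz[of "u s" e0] e0 by simp
    finally have "m * 1 \<le> m * norm (u s)" using m(1) by (intro mult_left_mono) auto
    then have "m \<le> N (u s)" using m(2)[of "u s"] by simp
    then have "\<bar>k s\<bar> * m \<le> \<bar>k s\<bar> * N (u s)" by (intro mult_left_mono) auto
    also have "\<dots> \<le> 2 * N e1" using F_bound[OF u_nz] by (simp add: k_def)
    finally show ?thesis using m(1) by (simp add: field_simps)
  qed
  define \<mu> where "\<mu> = H (n 0) / H (- n 0)"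
  have neg_pos: "H (- n s) > 0" and n_pos: "H (n s) > 0" for s
    using n_nz[of s] Gn[of s] by (intro H_pos; simp)+
  have quot: "H (n s) / H (- n s) = \<mu>" for s
    unfolding \<mu>_def
    by (rule common_log_subderivative_imp_proportional[where k = k and C = "2 * N e1 / m"])
       (use neg_pos n_pos step[of 1] step[of "- 1"] k_bound in simp_all)
  have ratio: "H (n s) = \<mu> * H (- n s)" for s
    using neg_pos[of s] quot[of s] by (simp add: divide_eq_eq)
  have ratio2: "H (t *\<^sub>R e1 + a *\<^sub>R e0) = \<mu> * H (- (t *\<^sub>R e1 + a *\<^sub>R e0))" if t: "t > 0" for t a
  proof -
    have "t *\<^sub>R e1 + a *\<^sub>R e0 = t *\<^sub>R n (a / t)" using t by (simp add: n_def algebra_simps)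
    then show ?thesis using H_scale[OF t, of "n (a / t)"] H_scale[OF t, of "- n (a / t)"] ratio[of "a / t"]
      by simp
  qed
  \<comment> \<open>Multiples of \<open>e0\<close> are not positive multiples of any
    \<open>n s\<close>; continuity of \<open>H\<close> reaches them.\<close>
  have ratio3: "H (a *\<^sub>R e0) = \<mu> * H (- (a *\<^sub>R e0))" for a
  proof (rule LIMSEQ_unique)
    have lim: "(\<lambda>i. inverse (real (Suc i)) *\<^sub>R e1 + a *\<^sub>R e0) \<longlonglongrightarrow> 0 *\<^sub>R e1 + a *\<^sub>R e0"
      by (intro tendsto_intros LIMSEQ_inverse_real_of_nat)
    have comp: "(\<lambda>i. H (X i)) \<longlonglongrightarrow> H y" if "X \<longlonglongrightarrow> y" for X y
      using H_cont that by (intro isCont_tendsto_compose[of y H]) (auto simp: continuous_on_eq_continuous_at)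
    show "(\<lambda>i. H (inverse (real (Suc i)) *\<^sub>R e1 + a *\<^sub>R e0)) \<longlonglongrightarrow> H (a *\<^sub>R e0)"
      using comp[OF lim] by simp
    have "(\<lambda>i. \<mu> * H (- (inverse (real (Suc i)) *\<^sub>R e1 + a *\<^sub>R e0))) \<longlonglongrightarrow> \<mu> * H (- (0 *\<^sub>R e1 + a *\<^sub>R e0))"
      by (intro tendsto_mult_left comp tendsto_minus lim)
    then show "(\<lambda>i. H (inverse (real (Suc i)) *\<^sub>R e1 + a *\<^sub>R e0)) \<longlonglongrightarrow> \<mu> * H (- (a *\<^sub>R e0))"
      by (subst ratio2) simp_all
  qed
  \<comment> \<open>The relation holds at both \<open>e0\<close> and \<open>- e0\<close>, so
    applying it twice gives \<mu> squared equal to 1.\<close>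
  have "\<mu> = 1"
  proof -
    have "e0 \<noteq> 0" using e0 by auto
    then have pos: "H e0 > 0" using e0 by (intro H_pos) auto
    have "H e0 = \<mu> * (\<mu> * H e0)" using ratio3[of 1] ratio3[of "- 1"] by simp
    then have "\<mu> * \<mu> = 1" using pos by simp
    moreover have "\<mu> > 0" using neg_pos[of 0] n_pos[of 0] by (simp add: \<mu>_def)
    ultimately show ?thesis by (metis abs_of_pos abs_1 abs_square_eq_1 power2_eq_square)
  qed
  have sym: "H q = H (- q)" if q: "G \<bullet> q = 0" for q
  proof -
    define a t where "a = q \<bullet> e0" and "t = q \<bullet> e1"
    have q_eq: "q = t *\<^sub>R e1 + a *\<^sub>R e0" 
      unfolding a_def t_def by (subst add.commute) (rule basis[OF q])
    consider "t > 0" | "t = 0" | "t < 0" by linarith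
    then show ?thesis
    proof cases
      case 1
      then show ?thesis using ratio2[of t a] \<open>\<mu> = 1\<close> by (simp add: q_eq)
    next
      case 2
      then show ?thesis using ratio3[of a] \<open>\<mu> = 1\<close> by (simp add: q_eq)
    next
      case 3
      then show ?thesis using ratio2[of "- t" "- a"] \<open>\<mu> = 1\<close> by (simp add: q_eq add.commute)
    qed
  qed

  have "convex K"
  proof (rule convexI)
    fix y z and a b :: real assume yz: "y \<in> K" "z \<in> K" and ab: "0 \<le> a" "0 \<le> b" "a + b = 1"
    have "v + (a *\<^sub>R y + b *\<^sub>R z) = a *\<^sub>R (v + y) + b *\<^sub>R (v + z)"
      using ab(3) by (simp add: algebra_simps flip: scaleR_add_left)
    then have "N (v + (a *\<^sub>R y + b *\<^sub>R z)) \<le> a * N (v + y) + b * N (v + z)"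
      using N_triangle[of "a *\<^sub>R (v + y)" "b *\<^sub>R (v + z)"] ab by (simp add: N_scaleR)
    also have "\<dots> \<le> a * r + b * r"
      using yz ab by (intro add_mono mult_left_mono) (auto simp: K_def)
    also have "\<dots> = r" using ab(3) by (simp flip: distrib_right)
    finally show "a *\<^sub>R y + b *\<^sub>R z \<in> K" using yz by (simp add: K_def inner_add_right)
  qed
  moreover have "closed K" unfolding K_def
    by (intro closed_Collect_conj closed_Collect_eq closed_Collect_le continuous_intros
        continuous_on_compose2[OF continuous_on_N[of UNIV]]) auto
  moreover have "- x \<notin> K" using not by (simp add: K_def)
  ultimately obtain p c where p: "p \<bullet> (- x) < c" "\<And>y. y \<in> K \<Longrightarrow> p \<bullet> y > c"
    using separating_hyperplane_closed_point[of K "- x"] by blast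
  \<comment> \<open>Only the part of the separating functional along \<open>ker G\<close> matters.
    Separation gives \<open>H (- q) \<le> - c < q \<bullet> x \<le> H q\<close>, against symmetry of
    \<open>H\<close>.\<close>
  define q where "q = p - ((p \<bullet> G) / (G \<bullet> G)) *\<^sub>R G"
  have GG: "G \<bullet> G \<noteq> 0" using G0 by simp
  have Gq: "G \<bullet> q = 0" using GG by (simp add: q_def inner_diff_right inner_commute)
  have qp: "q \<bullet> y = p \<bullet> y" if "G \<bullet> y = 0" for y using that by (simp add: q_def inner_diff_left)
  have xK: "x \<in> K" using x by (simp add: K_def)
  have "H (- q) \<le> - c" using p(2) qp by (intro H_le) (force simp: K_def)
  moreover have "q \<bullet> x > - c" using p(1) qp[OF x(1)] by simp
  ultimately show False using H_ge[OF xK, of q] sym[OF Gq] by simp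
qed

lemma N_reflection:
  assumes v: "v \<in> face" and x: "G \<bullet> x = 0"
  shows "N (v + x) = N (v - x)"
proof -
  have le: "N (v - x) \<le> N (v + x)" if x: "G \<bullet> x = 0" for x
  \<comment> \<open>The radius \<open>N (v + x)\<close> may equal 1, but
    \<open>section_symmetric\<close> needs more, so it is enlarged by \<open>e\<close>.\<close>
  proof (rule field_le_epsilon)
    fix e :: real assume e: "e > 0"
    have "1 \<le> N (v + x)" using G_le[of "v + x"] x v by (simp add: face_def inner_add_right)
    with e show "N (v - x) \<le> N (v + x) + e"
      by (intro section_symmetric[OF v _ x]) auto
  qed
  show ?thesis using le[OF x] le[of "- x"] x by simp
qed

end

section \<open>Reflections and the inner product\<close>

locale flinn_space =
  fixes f :: "'a::real_normed_vector \<Rightarrow> 'a \<Rightarrow> real"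
  assumes linear_f: "u \<noteq> 0 \<Longrightarrow> linear (f u)"
    and f_self: "u \<noteq> 0 \<Longrightarrow> f u u = 1"
    and f_contraction: "u \<noteq> 0 \<Longrightarrow> norm (x - f u x *\<^sub>R u) \<le> norm x"
    and dim3: "\<exists>S :: 'a set. finite S \<and> card S = 3 \<and> independent S"
begin

lemma third_direction: "\<exists>e. e \<notin> span {v, w :: 'a}"
proof (rule ccontr)
  assume "\<not> ?thesis"
  then have sub: "S \<subseteq> span {v, w}" for S by auto
  obtain S :: "'a set" where S: "card S = 3" "independent S" using dim3 by blast
  have "card S \<le> card {v, w}" using independent_span_bound[OF _ S(2) sub] by simp
  also have "card {v, w} \<le> 2" by (simp add: card_insert_if)
  finally show False using S(1) by simp
qed

text \<open>A third independent vector embeds \<open>v\<close> and \<open>w\<close> in a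
  three-dimensional subspace. The contractions for its vectors preserve it, so
  \<open>N_reflection\<close> applies to the norm pulled back along \<open>L\<close>.\<close>

lemma norm_support_reflection:
  fixes v w :: 'a
  assumes G: "linear G" "\<And>x. G x \<le> norm x" and v: "G v = norm v" and w: "G w = 0"
  shows "norm (v + w) = norm (v - w)"
proof (cases "v = 0 \<or> w = 0")
  case False
  then have v0: "v \<noteq> 0" and w0: "w \<noteq> 0" by auto
  obtain e where e: "e \<notin> span {v, w}" using third_direction by blast
  define L where "L z = z $ 1 *\<^sub>R v + z $ 2 *\<^sub>R w + z $ 3 *\<^sub>R e" for z :: "real^3"
  have L: "linear L" by (rule linearI) (simp_all add: L_def algebra_simps)
  have L_inj: "z = 0" if "L z = 0" for z
  proof -
    have z3: "z $ 3 = 0"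
    proof (rule ccontr)
      assume "z $ 3 \<noteq> 0"
      moreover from that have "z $ 3 *\<^sub>R e = (- (z $ 1)) *\<^sub>R v + (- (z $ 2)) *\<^sub>R w"
        by (simp add: L_def add_eq_0_iff algebra_simps)
      ultimately have "e = inverse (z $ 3) *\<^sub>R ((- (z $ 1)) *\<^sub>R v + (- (z $ 2)) *\<^sub>R w)"
        by (metis scaleR_one scaleR_scaleR left_inverse)
      also have "\<dots> \<in> span {v, w}" by (intro span_scale span_add span_base) auto
      finally show False using e by simp
    qed
    with that have eq: "z $ 1 *\<^sub>R v + z $ 2 *\<^sub>R w = 0" by (simp add: L_def)
    then have "G (z $ 1 *\<^sub>R v + z $ 2 *\<^sub>R w) = 0" using linear_0[OF G(1)] by simp
    then have z1: "z $ 1 = 0" using v0 by (simp add: linear_add[OF G(1)] linear_scale[OF G(1)] v w)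
    with eq w0 have "z $ 2 = 0" by simp
    with z1 z3 show ?thesis by (simp add: vec_eq_iff forall_3)
  qed
  define N where "N z = norm (L z)" for z
  have functional: "\<exists>a. \<forall>z. a \<bullet> z = g (L z)" if "linear g" for g :: "'a \<Rightarrow> real"
  proof -
    have "linear (\<lambda>z. g (L z))" using linear_compose[OF L that] by (simp add: o_def)
    from adjoint_works[OF this, of _ 1] show ?thesis
      by (intro exI[of _ "adjoint (\<lambda>z. g (L z)) 1"]) (simp add: inner_commute)
  qed
  have "\<exists>a. \<forall>z. a \<bullet> z = f (L u) (L z)" if "u \<noteq> 0" for u
    using L_inj[of u] that by (intro functional linear_f) auto
  then obtain F where F: "\<And>u z. u \<noteq> 0 \<Longrightarrow> F u \<bullet> z = f (L u) (L z)" by metis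
  obtain g where g: "\<And>z. g \<bullet> z = G (L z)" using functional[OF G(1)] by blast
  interpret flinn_norm3_support N F g
  proof
    show "N x = 0 \<longleftrightarrow> x = 0" for x using L_inj[of x] linear_0[OF L] by (auto simp: N_def)
    show "N (c *\<^sub>R x) = \<bar>c\<bar> * N x" for c x by (simp add: N_def linear_scale[OF L])
    show "N (x + y) \<le> N x + N y" for x y by (simp add: N_def linear_add[OF L] norm_triangle_ineq)
    show "F u \<bullet> u = 1" if "u \<noteq> 0" for u using F[OF that] f_self[of "L u"] L_inj that by auto
    show "N (x - (F u \<bullet> x) *\<^sub>R u) \<le> N x" if "u \<noteq> 0" for x u
      using f_contraction[of "L u" "L x"] L_inj[of u] that
      by (auto simp: N_def F[OF that] linear_diff[OF L] linear_scale[OF L])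
    show "g \<bullet> x \<le> N x" for x using G(2) by (simp add: g N_def)
  qed
  \<comment> \<open>Scaling by \<open>c\<close> puts \<open>v\<close> on the face, where
    \<open>G\<close> must equal 1.\<close>
  define c where "c = inverse (norm v)"
  have Lv: "L (axis 1 c) = c *\<^sub>R v" and Lw: "L (axis 2 c) = c *\<^sub>R w"
    by (simp_all add: L_def axis_def)
  have "G (c *\<^sub>R v) = 1" "norm (c *\<^sub>R v) = 1" using v0 by (simp_all add: linear_scale[OF G(1)] v c_def)
  then have "axis 1 c \<in> face" by (simp add: face_def g N_def Lv)
  moreover have "g \<bullet> axis 2 c = 0" by (simp add: g Lw linear_scale[OF G(1)] w)
  ultimately have "N (axis 1 c + axis 2 c) = N (axis 1 c - axis 2 c)" by (rule N_reflection)
  then have "norm (c *\<^sub>R (v + w)) = norm (c *\<^sub>R (v - w))"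
    by (simp add: N_def linear_add[OF L] linear_diff[OF L] Lv Lw scaleR_add_right scaleR_diff_right)
  then show ?thesis using v0 by (simp add: c_def)
qed auto

section \<open>Symmetry centres of the norm on lines, and reflections\<close>

lemma f_diff: "u \<noteq> 0 \<Longrightarrow> f u (x - y) = f u x - f u y"
  and f_add: "u \<noteq> 0 \<Longrightarrow> f u (x + y) = f u x + f u y"
  and f_scaleR: "u \<noteq> 0 \<Longrightarrow> f u (c *\<^sub>R x) = c * f u x"
  using linear_f[of u] by (auto simp: linear_diff linear_add linear_scale)

text \<open>A norming functional of \<open>v\<close> is composed with the contraction for
  \<open>u\<close>, which fixes \<open>v\<close> and kills \<open>u\<close>.\<close>

lemma support_functional_exists:
  assumes u: "u \<noteq> 0" and v: "f u v = 0"
  obtains G where "linear G" "\<And>x. G x \<le> norm x" "G v = norm v" "G u = 0"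
proof -
  obtain g where g: "linear g" "\<And>x. g x \<le> norm x" "g v = norm v"
    using norming_functional_exists[of v] by blast
  define G where "G x = g (x - f u x *\<^sub>R u)" for x
  have "linear G" using g(1) f_add[OF u] f_scaleR[OF u]
    by (intro linearI) (simp_all add: G_def linear_diff linear_add linear_scale algebra_simps)
  moreover have "G x \<le> norm x" for x
    using g(2)[of "x - f u x *\<^sub>R u"] f_contraction[OF u, of x] by (simp add: G_def)
  moreover have "G v = norm v" "G u = 0"
    using g v f_self[OF u] by (simp_all add: G_def linear_0)
  ultimately show ?thesis by (rule that)
qed

text \<open>This is the isometry property of the reflection for \<open>u\<close>: it fixes
  \<open>v\<close> and reverses \<open>u\<close>.\<close>

lemma norm_even:
  assumes "u \<noteq> 0" "f u v = 0"
  shows "norm (v + t *\<^sub>R u) = norm (v - t *\<^sub>R u)"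
proof -
  obtain G where "linear G" "\<And>x. G x \<le> norm x" "G v = norm v" "G u = 0"
    using support_functional_exists[OF assms] by blast
  then show ?thesis by (intro norm_support_reflection[of G]) (simp_all add: linear_scale)
qed

text \<open>Two distinct centres compose to a translation by \<open>2 * c\<close>, so the norm would
  be periodic along a line on which it is unbounded.\<close>

lemma symmetry_centre_unique:
  fixes v u :: 'a
  assumes u: "u \<noteq> 0"
    and even0: "\<And>t. norm (v + t *\<^sub>R u) = norm (v - t *\<^sub>R u)"
    and evenc: "\<And>t. norm (v + c *\<^sub>R u + t *\<^sub>R u) = norm (v + c *\<^sub>R u - t *\<^sub>R u)"
  shows "c = 0"
proof (rule ccontr)
  assume c: "c \<noteq> 0"
  define h where "h t = norm (v + t *\<^sub>R u)" for t
  have per: "h (t + 2 * c) = h t" for t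
  proof -
    have "h (t + 2 * c) = norm (v + c *\<^sub>R u + (t + c) *\<^sub>R u)" 
      by (simp add: h_def algebra_simps scaleR_2 flip: scaleR_scaleR)
    also have "\<dots> = norm (v + c *\<^sub>R u - (t + c) *\<^sub>R u)" by (rule evenc)
    also have "\<dots> = norm (v - t *\<^sub>R u)" by (simp add: algebra_simps)
    also have "\<dots> = h t" unfolding h_def by (rule even0[symmetric])
    finally show ?thesis .
  qed
  have hn: "h (real n * (2 * c)) = h 0" for n
  proof (induction n)
    case (Suc n)
    then show ?case using per[of "real n * (2 * c)"] by (simp add: algebra_simps)
  qed simp
  have bound: "real n * (2 * \<bar>c\<bar> * norm u) \<le> 2 * norm v" for n
  proof -
    have "norm ((real n * (2 * c)) *\<^sub>R u) \<le> norm (v + (real n * (2 * c)) *\<^sub>R u) + norm v"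
      using norm_triangle_ineq4[of "v + (real n * (2 * c)) *\<^sub>R u" v] by simp
    then show ?thesis using hn[of n] by (simp add: h_def abs_mult mult.assoc)
  qed
  have "2 * \<bar>c\<bar> * norm u > 0" using c u by simp
  then obtain n where "2 * norm v < real n * (2 * \<bar>c\<bar> * norm u)"
    using reals_Archimedean3 by blast
  with bound[of n] show False by simp
qed

text \<open>Otherwise the functional supporting at \<open>v\<close> and killing \<open>u\<close>
  also supports at \<open>v + b u\<close>, making that point a second symmetry centre.\<close>

lemma no_support_segment:
  fixes b :: real
  assumes u: "u \<noteq> 0" and v: "f u v = 0" and le: "norm (v + b *\<^sub>R u) \<le> norm v"
  shows "b = 0"
proof -
  obtain G where G: "linear G" "\<And>x. G x \<le> norm x" "G v = norm v" "G u = 0"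
    using support_functional_exists[OF u v] by blast
  have "G (v + b *\<^sub>R u) = norm v" using G by (simp add: linear_add linear_scale)
  then have "G (v + b *\<^sub>R u) = norm (v + b *\<^sub>R u)" using le G(2)[of "v + b *\<^sub>R u"] by simp
  then have "norm (v + b *\<^sub>R u + t *\<^sub>R u) = norm (v + b *\<^sub>R u - t *\<^sub>R u)" for t
    using G by (intro norm_support_reflection[OF G(1,2)]) (simp_all add: linear_scale)
  then show ?thesis using symmetry_centre_unique[OF u norm_even[OF u v]] by blast
qed

text \<open>The claim is that the symmetry centre \<open>v\<close> of the line through
  \<open>x\<close> and \<open>y\<close> is their midpoint. Along the line the norm is even and
  convex about \<open>v\<close>, and strictly minimal there by
  \<open>no_support_segment\<close>.\<close>

lemma f_diff_sum_zero:
  assumes xy: "norm x = norm y" "x \<noteq> y"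
  shows "f (x - y) (x + y) = 0"
proof -
  define u where "u = x - y"
  have u: "u \<noteq> 0" using xy by (simp add: u_def)
  define p where "p = (1/2) *\<^sub>R (x + y)"
  define k where "k = f u p"
  define v where "v = p - k *\<^sub>R u"
  have v: "f u v = 0" by (simp add: v_def f_diff[OF u] f_scaleR[OF u] f_self[OF u] k_def)
  have xp: "x = p + (1/2) *\<^sub>R u" and yp: "y = p - (1/2) *\<^sub>R u"
    unfolding p_def u_def by (simp_all flip: scaleR_add_right scaleR_diff_right)
  have x_eq: "x = v + (k + 1/2) *\<^sub>R u" and y_eq: "y = v + (k - 1/2) *\<^sub>R u"
    using xp yp by (simp_all add: v_def scaleR_add_left scaleR_diff_left)
  define h where "h t = norm (v + t *\<^sub>R u)" for t
  have even: "h (- t) = h t" for t using norm_even[OF u v, of t] by (simp add: h_def)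
  have h_abs: "h \<bar>t\<bar> = h t" for t using even[of t] by (cases "t \<ge> 0") auto
  have "k = 0"
  proof (rule ccontr)
    assume k: "k \<noteq> 0"
    \<comment> \<open>These are the distances of the parameters \<open>k - 1/2\<close> and
      \<open>k + 1/2\<close> from the centre, in increasing order. Equal values at
      \<open>a < b\<close> force, by convexity, \<open>h b \<le> h 0\<close>.\<close>
    define a b where "a = \<bar>\<bar>k\<bar> - 1/2\<bar>" and "b = \<bar>k\<bar> + 1/2"
    have ab: "0 \<le> a" "a < b" using k by (auto simp: a_def b_def)
    have "h (k + 1/2) = h (k - 1/2)" using xy(1) x_eq y_eq by (simp add: h_def)
    then have hab: "h a = h b"
      unfolding a_def b_def h_abs using even[of "k + 1/2"] even[of "k - 1/2"]
      by (cases "k \<ge> 0") (auto simp: abs_if algebra_simps)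
    define s where "s = a / b"
    have s: "0 \<le> s" "s < 1" using ab by (auto simp: s_def)
    have "v + a *\<^sub>R u = (1 - s) *\<^sub>R v + s *\<^sub>R (v + b *\<^sub>R u)"
      using ab by (simp add: s_def algebra_simps)
    then have "h a \<le> norm ((1 - s) *\<^sub>R v) + norm (s *\<^sub>R (v + b *\<^sub>R u))"
      unfolding h_def by (metis norm_triangle_ineq)
    then have "h b \<le> (1 - s) * norm v + s * h b" using s hab by (simp add: h_def)
    then have "(1 - s) * h b \<le> (1 - s) * norm v" by (simp add: algebra_simps)
    then have "h b \<le> norm v" using s by simp
    then have "b = 0" using no_support_segment[OF u v] by (simp add: h_def)
    then show False using ab by simp
  qed
  then have "(1/2) * f u (x + y) = 0" using f_scaleR[OF u, of "1/2" "x + y"] by (simp add: k_def p_def)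
  then show ?thesis by (simp add: u_def)
qed

text \<open>The reflection in \<open>x - u\<close> is an isometry exchanging \<open>x\<close> and \<open>u\<close>; it carries the symmetry
  centre of the line \<open>x + \<real>u\<close> to that of \<open>u + \<real>x\<close>.\<close>

lemma f_symmetric:
  assumes xu: "norm x = norm u" "u \<noteq> 0"
  shows "f u x = f x u"
proof (cases "x = u")
  case False
  have x: "x \<noteq> 0" using xu by auto
  define w where "w = x - u"
  have w: "w \<noteq> 0" using False by (simp add: w_def)
  define R where "R y = y - (2 * f w y) *\<^sub>R w" for y
  have R_lin: "R (a *\<^sub>R y + b *\<^sub>R z) = a *\<^sub>R R y + b *\<^sub>R R z" for a b y z
    by (simp add: R_def f_add[OF w] f_scaleR[OF w] algebra_simps)
  have R_norm: "norm (R y) = norm y" for y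
  proof -
    have "f w (y - f w y *\<^sub>R w) = 0" by (simp add: f_diff[OF w] f_scaleR[OF w] f_self[OF w])
    from norm_even[OF w this, of "f w y"] show ?thesis
      by (simp add: R_def algebra_simps flip: scaleR_add_left)
  qed
  \<comment> \<open>Hence \<open>f w\<close> takes the values \<open>1/2\<close> and
    \<open>- 1/2\<close> at \<open>x\<close> and \<open>u\<close>, exactly what \<open>R\<close>
    needs to exchange them.\<close>
  have "f w x - f w u = 1" using f_self[OF w] f_diff[OF w, of x u] by (simp add: w_def)
  moreover have "f w x + f w u = 0"
    using f_diff_sum_zero[OF xu(1) False] f_add[OF w] by (simp add: w_def)
  ultimately have "2 * f w x = 1" "2 * f w u = - 1" by simp_all
  then have Rx: "R x = u" and Ru: "R u = x" by (simp_all add: R_def w_def)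
  define a where "a = f u x"
  define b where "b = f x u"
  have "norm (u - a *\<^sub>R x + t *\<^sub>R x) = norm (u - a *\<^sub>R x - t *\<^sub>R x)" for t
  proof -
    have "f u (x - a *\<^sub>R u) = 0"
      by (simp add: a_def f_diff[OF xu(2)] f_scaleR[OF xu(2)] f_self[OF xu(2)])
    from norm_even[OF xu(2) this, of t]
    have "norm (R (1 *\<^sub>R x + (t - a) *\<^sub>R u)) = norm (R (1 *\<^sub>R x + (- t - a) *\<^sub>R u))"
      unfolding R_norm by (simp add: algebra_simps)
    then show ?thesis unfolding R_lin Rx Ru by (simp add: algebra_simps)
  qed
  moreover have "f x (u - b *\<^sub>R x) = 0"
    by (simp add: b_def f_diff[OF x] f_scaleR[OF x] f_self[OF x])
  note norm_even[OF x this]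
  ultimately have "b - a = 0"
    by (intro symmetry_centre_unique[OF x, of "u - b *\<^sub>R x"]) (simp_all add: algebra_simps)
  then show ?thesis by (simp add: a_def b_def)
qed simp

lemma norm_from_inner_product: "norm_from_inner_product TYPE('a)"
proof -
  \<comment> \<open>The family \<open>f\<close> was chosen without homogeneity in its index, so
    \<open>u\<close> is normalised first. Symmetry then reduces to unit vectors, and the factor
    \<open>norm u\<close> settles \<open>u = 0\<close>.\<close>
  define ip where "ip x u = norm u * f (u /\<^sub>R norm u) x" for x u
  have sym: "ip x u = ip u x" for x u
  proof (cases "x = 0 \<or> u = 0")
    case True
    then show ?thesis by (cases "x = 0"; cases "u = 0"; simp add: ip_def linear_0[OF linear_f])
  next
    case False
    define x' u' where "x' = x /\<^sub>R norm x" and "u' = u /\<^sub>R norm u"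
    have n: "norm x' = 1" "norm u' = 1" and nz: "x' \<noteq> 0" "u' \<noteq> 0" using False by (auto simp: x'_def u'_def)
    have "x = norm x *\<^sub>R x'" "u = norm u *\<^sub>R u'" using False by (auto simp: x'_def u'_def)
    then have "f u' x = norm x * f u' x'" "f x' u = norm u * f x' u'"
      using f_scaleR nz by metis+
    moreover have "f u' x' = f x' u'" using n nz by (intro f_symmetric) auto
    ultimately show ?thesis by (simp add: ip_def x'_def u'_def)
  qed
  have lin: "linear (\<lambda>x. ip x u)" for u
  proof (cases "u = 0")
    case True
    then show ?thesis by (simp add: ip_def linear_zero)
  next
    case False
    then have "u /\<^sub>R norm u \<noteq> 0" by simp
    from f_add[OF this] f_scaleR[OF this] show ?thesis
      by (intro linearI) (simp_all add: ip_def algebra_simps)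
  qed
  have sq: "ip x x = (norm x)\<^sup>2" for x
  proof (cases "x = 0")
    case False
    define x' where "x' = x /\<^sub>R norm x"
    have nz: "x' \<noteq> 0" and x: "x = norm x *\<^sub>R x'" using False by (auto simp: x'_def)
    have "f x' x = norm x * f x' x'" using f_scaleR[OF nz] x by metis
    then show ?thesis using f_self[OF nz] by (simp add: ip_def x'_def power2_eq_square)
  qed (simp add: ip_def)
  show ?thesis unfolding norm_from_inner_product_def
    using sym lin sq by (intro exI[of _ ip]) auto
qed

end

theorem theorem2p6:
  assumes dim3: "\<exists>S :: ('a::banach) set. finite S \<and> card S = 3 \<and> independent S"
    and all_flinn: "flinn_set = (UNIV :: 'a set)"
  shows "norm_from_inner_product TYPE('a)"
proof -
  have "\<exists>g. linear g \<and> g u = 1 \<and> (\<forall>x. norm (x - g x *\<^sub>R u) \<le> norm x)" if "u \<noteq> 0" for u :: 'a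
  proof -
    have "flinn_element u" using all_flinn by (auto simp: flinn_set_def)
    from flinn_element_functional[OF this that] show ?thesis by blast
  qed
  then obtain f :: "'a \<Rightarrow> 'a \<Rightarrow> real" where f: "\<And>u. u \<noteq> 0 \<Longrightarrow> linear (f u)"
    "\<And>u. u \<noteq> 0 \<Longrightarrow> f u u = 1" "\<And>u x. u \<noteq> 0 \<Longrightarrow> norm (x - f u x *\<^sub>R u) \<le> norm x"
    by metis
  interpret flinn_space f by (rule flinn_space.intro) (fact f dim3)+
  show ?thesis by (rule norm_from_inner_product)
qed

end
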